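(* Let $\alpha,\beta,\gamma\in\mathbb{C}$ and let $(P_n(x))_{n\ge0}$ be the family of polynomials defined by $P_0(x)=1$, $P_1(x)=x-\alpha-\beta$ and $$P_n(x)=(x-\alpha)P_{n-1}(x)-\beta(x-\gamma)P_{n-2}(x),\qquad n\ge2.$$ Then the coefficient array of the polynomials $P_n(x)$ is the Riordan array $$\left(\frac{1-\beta x}{1+\alpha x-\beta\gamma x^2},\ \frac{x(1-\beta x)}{1+\alpha x-\beta\gamma x^2}\right).$$
   Context: For formal power series $g(x)=1+g_1x+\cdots$ and $f(x)=x+f_2x^2+\cdots$, the Riordan array $(g,f)$ is the infinite lower-triangular matrix (rows and columns indexed from $0$) whose $(n,k)$ entry is $[x^n]\,g(x)f(x)^k$, where $[x^n]$ denotes extraction of the coefficient of $x^n$. The coefficient array of polynomials $P_n(x)=\sum_{k=0}^n d_{n,k}x^k$ is the infinite lower-triangular matrix $(d_{n,k})_{n,k\ge0}$. *)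

theory Defs
  imports
    Complex_Main
    "HOL-Computational_Algebra.Polynomial"
    "HOL-Computational_Algebra.Formal_Power_Series"
begin

text \<open>
  Infinite matrices with rows and columns indexed from 0 are functions of type
  \<open>nat \<Rightarrow> nat \<Rightarrow> 'a\<close>, with the row index first.
\<close>

definition lower_triangular :: "(nat \<Rightarrow> nat \<Rightarrow> 'a::zero) \<Rightarrow> bool"
  where "lower_triangular D \<longleftrightarrow> (\<forall>n k. n < k \<longrightarrow> D n k = 0)"

definition riordan_pair :: "'a::comm_ring_1 fps \<Rightarrow> 'a fps \<Rightarrow> bool"
  where "riordan_pair g f \<longleftrightarrow>
    fps_nth g 0 = 1 \<and> fps_nth f 0 = 0 \<and> fps_nth f 1 = 1"

text \<open>The following is meant only for \<open>g\<close> and \<open>f\<close> with \<open>riordan_pair g f\<close>.\<close>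

definition riordan_array :: "'a::comm_ring_1 fps \<Rightarrow> 'a fps \<Rightarrow> nat \<Rightarrow> nat \<Rightarrow> 'a"
  where "riordan_array g f n k = fps_nth (g * f ^ k) n"

text \<open>
  A relation rather than a function, because \<open>P\<close> has a (then unique) coefficient array
  only if \<open>P n\<close> has degree at most \<open>n\<close> for all \<open>n\<close>.
\<close>

definition is_coefficient_array ::
    "(nat \<Rightarrow> nat \<Rightarrow> 'a::comm_ring_1) \<Rightarrow> (nat \<Rightarrow> 'a poly) \<Rightarrow> bool"
  where "is_coefficient_array D P \<longleftrightarrow>
    lower_triangular D \<and> (\<forall>n. P n = (\<Sum>k=0..n. monom (D n k) k))"

end

theory Submission
  imports Defs
begin

text \<open>
  Fix \<open>k\<close> and collect the coefficients of \<open>x ^ k\<close> in \<open>P 0, P 1, P 2, \<dots>\<close> into a power series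
  \<open>F k\<close> in a new variable \<open>t\<close>, the generating function of the \<open>k\<close>-th column of the coefficient
  array. Put \<open>N = 1 - \<beta> t\<close> and \<open>D = 1 + \<alpha> t - \<beta> \<gamma> t\<^sup>2\<close>, so that \<open>g = N / D\<close> and \<open>f = t N / D\<close>.
  In the recurrence \<open>P n + \<alpha> P (n - 1) - \<beta> \<gamma> P (n - 2) = x P (n - 1) - \<beta> x P (n - 2)\<close> the left
  side acts within each column, as multiplication by \<open>D\<close>, and the right side moves column \<open>k\<close>
  to column \<open>k + 1\<close> while multiplying it by \<open>t N\<close>. Hence \<open>D * F (k + 1) = t * N * F k\<close>
  (\<open>column_gf_Suc\<close>), whereas column \<open>0\<close> receives nothing from the right and is determined by
  the initial values: \<open>D * F 0 = N\<close> (\<open>column_gf_0\<close>). Dividing by the unit \<open>D\<close> yields \<open>F 0 = g\<close>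
  and \<open>F (k + 1) = f * F k\<close>, so \<open>F k = g * f ^ k\<close>, which is the \<open>k\<close>-th column of the Riordan
  array.
\<close>

definition column_gf :: "(nat \<Rightarrow> 'a::zero poly) \<Rightarrow> nat \<Rightarrow> 'a fps"
  where "column_gf P k = Abs_fps (\<lambda>n. coeff (P n) k)"

text \<open>Since \<open>f\<close> has no constant term, \<open>f ^ k\<close> is divisible by the \<open>k\<close>-th power of the variable.\<close>

lemma lower_triangular_riordan_array:
  fixes g f :: "'a::comm_ring_1 fps"
  assumes "fps_nth f 0 = 0"
  shows "lower_triangular (riordan_array g f)"
  unfolding lower_triangular_def riordan_array_def
proof (intro allI impI)
  fix n k :: nat
  assume "n < k"
  then have "fps_nth (f ^ k) (n - i) = 0" for i
    using startsby_zero_power_prefix[OF assms, of k] by simp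
  then show "fps_nth (g * f ^ k) n = 0"
    by (simp add: fps_mult_nth)
qed

text \<open>
  Lower triangularity carries the degree bound: it makes all coefficients of \<open>P n\<close> beyond the
  \<open>n\<close>-th vanish, so that the truncated sum in \<open>is_coefficient_array\<close> loses nothing.
\<close>

lemma is_coefficient_arrayI:
  assumes "lower_triangular D" and coeff_P: "\<And>n k. coeff (P n) k = D n k"
  shows "is_coefficient_array D P"
  unfolding is_coefficient_array_def
proof (intro conjI allI)
  fix n
  show "P n = (\<Sum>k=0..n. monom (D n k) k)"
    using assms(1) by (auto simp: poly_eq_iff coeff_sum coeff_P lower_triangular_def)
qed fact

text \<open>
  From index \<open>2\<close> on, such a product applies a three-term recurrence operator to the coefficients
  of \<open>F\<close>; the indices \<open>0\<close> and \<open>1\<close>, where the operator is cut off, are where the initial values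
  of a recurrence enter.
\<close>

lemma fps_nth_quadratic_mult:
  fixes F :: "'a::comm_ring_1 fps"
  defines "Q a b \<equiv> 1 + fps_const a * fps_X - fps_const b * fps_X ^ 2"
  shows "fps_nth (Q a b * F) 0 = fps_nth F 0" (is ?zero)
    and "fps_nth (Q a b * F) (Suc 0) = fps_nth F (Suc 0) + a * fps_nth F 0"
      (is ?one)
    and "fps_nth (Q a b * F) (Suc (Suc n)) =
      fps_nth F (Suc (Suc n)) + a * fps_nth F (Suc n) - b * fps_nth F n"
      (is ?step)
proof -
  have "Q a b * F = F + fps_const a * (fps_X * F) - fps_const b * (fps_X * (fps_X * F))"
    by (simp add: Q_def algebra_simps power2_eq_square)
  then show ?zero and ?one and ?step
    by simp_all
qed

context
  fixes \<alpha> \<beta> \<gamma> :: "'a::comm_ring_1" and P :: "nat \<Rightarrow> 'a poly"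
  assumes P0: "P 0 = 1"
    and P1: "P 1 = [:- \<alpha> - \<beta>, 1:]"
    and P_rec: "\<And>n. n \<ge> 2 \<Longrightarrow>
      P n = [:- \<alpha>, 1:] * P (n - 1) - smult \<beta> ([:- \<gamma>, 1:] * P (n - 2))"
begin

text \<open>
  The constant terms satisfy the recurrence with characteristic series \<open>D\<close>, so the product
  vanishes from index \<open>2\<close> on. At index \<open>1\<close> it is \<open>(- \<alpha> - \<beta>) + \<alpha>\<close>: the summand \<open>- \<beta>\<close> by which
  \<open>P 1\<close> differs from \<open>(x - \<alpha>) P 0\<close> produces the numerator \<open>1 - \<beta> t\<close>.
\<close>

lemma column_gf_0:
  "(1 + fps_const \<alpha> * fps_X - fps_const (\<beta> * \<gamma>) * fps_X ^ 2) * column_gf P 0 =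
    1 - fps_const \<beta> * fps_X"
  (is "?l = ?r")
proof (rule fps_ext)
  fix n
  consider "n = 0" | "n = Suc 0" | m where "n = Suc (Suc m)"
    by (metis not0_implies_Suc)
  then show "fps_nth ?l n = fps_nth ?r n"
    using P1
    by cases (simp_all only: fps_nth_quadratic_mult,
      simp_all add: column_gf_def P0 P_rec algebra_simps)
qed

text \<open>
  The correction \<open>- \<beta>\<close> in \<open>P 1\<close> lies in column \<open>0\<close>. In all later columns \<open>P 1\<close> agrees with
  \<open>(x - \<alpha>) P 0\<close>, so the shift by one column holds from index \<open>0\<close> on, without boundary terms.
\<close>

lemma column_gf_Suc:
  "(1 + fps_const \<alpha> * fps_X - fps_const (\<beta> * \<gamma>) * fps_X ^ 2) * column_gf P (Suc k) =
    fps_X * (1 - fps_const \<beta> * fps_X) * column_gf P k"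
  (is "?l = ?r")
proof (rule fps_ext)
  fix n
  \<comment> \<open>Written with \<open>fps_X\<close> outermost, the right side is evaluated by index shifts alone.\<close>
  have r: "?r = fps_X * (column_gf P k - fps_const \<beta> * (fps_X * column_gf P k))"
    by (simp add: algebra_simps)
  consider "n = 0" | "n = Suc 0" | m where "n = Suc (Suc m)"
    by (metis not0_implies_Suc)
  then show "fps_nth ?l n = fps_nth ?r n"
    unfolding r using P1
    by cases (simp_all only: fps_nth_quadratic_mult,
      simp_all add: column_gf_def P0 P_rec algebra_simps coeff_pCons split: nat.split)
qed

end

theorem proposition13:
  fixes \<alpha> \<beta> \<gamma> :: complex
    and P :: "nat \<Rightarrow> complex poly"
    and g f :: "complex fps"
  assumes P0: "P 0 = 1"
    and P1: "P 1 = [:- \<alpha> - \<beta>, 1:]"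
    and P_rec: "\<And>n. n \<ge> 2 \<Longrightarrow>
      P n = [:- \<alpha>, 1:] * P (n - 1) - smult \<beta> ([:- \<gamma>, 1:] * P (n - 2))"
  defines "g \<equiv> (1 - fps_const \<beta> * fps_X) /
      (1 + fps_const \<alpha> * fps_X - fps_const (\<beta> * \<gamma>) * fps_X ^ 2)"
    and "f \<equiv> (fps_X * (1 - fps_const \<beta> * fps_X)) /
      (1 + fps_const \<alpha> * fps_X - fps_const (\<beta> * \<gamma>) * fps_X ^ 2)"
  shows "riordan_pair g f \<and> is_coefficient_array (riordan_array g f) P"
proof -
  define N where "N = 1 - fps_const \<beta> * fps_X"
  define D where "D = 1 + fps_const \<alpha> * fps_X - fps_const (\<beta> * \<gamma>) * fps_X ^ 2"
  have D0: "fps_nth D 0 = 1"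
    by (simp add: D_def)
  then have "D \<noteq> 0"
    by auto
  have Dg: "D * g = N" and Df: "D * f = fps_X * N"
    using D0 by (simp_all add: g_def f_def N_def D_def fps_divide_unit inverse_mult_eq_1'
        mult.left_commute)
  have g0: "fps_nth g 0 = 1" and f0: "fps_nth f 0 = 0" and f1: "fps_nth f 1 = 1"
    using arg_cong[OF Dg, of "\<lambda>F. fps_nth F 0"] arg_cong[OF Df, of "\<lambda>F. fps_nth F 0"]
      arg_cong[OF Df, of "\<lambda>F. fps_nth F 1"]
    by (simp_all add: fps_mult_nth_1 N_def D0)

  have column: "column_gf P k = g * f ^ k" for k
  proof (induction k)
    case 0
    have "D * column_gf P 0 = D * g"
      unfolding Dg unfolding D_def N_def by (rule column_gf_0[OF P0 P1 P_rec])
    with \<open>D \<noteq> 0\<close> show ?case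
      by simp
  next
    case (Suc k)
    have "D * column_gf P (Suc k) = fps_X * N * column_gf P k"
      unfolding D_def N_def by (rule column_gf_Suc[OF P0 P1 P_rec])
    also have "\<dots> = D * (g * f ^ Suc k)"
      using Suc by (simp flip: Df add: ac_simps)
    finally show ?case
      using \<open>D \<noteq> 0\<close> by simp
  qed
  have "coeff (P n) k = riordan_array g f n k" for n k
    using column[of k] by (simp add: riordan_array_def column_gf_def fps_eq_iff)
  with g0 f0 f1 show ?thesis
    by (simp add: riordan_pair_def is_coefficient_arrayI lower_triangular_riordan_array)
qed

end
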